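(* Let $\Gamma$, $D$, $q$, $H$, the vector space $\Lambda$ and the maps $A^{(i)},A^{*(i)}$ be as described in the context. View $\Lambda$ as the $U'_q(\mathfrak{so}_6)$-module on which \[ B_1=\frac{A^{*(1)}}{H(q^2-q^{-2})},\quad B_3=\frac{A^{*(2)}}{H(q^2-q^{-2})},\quad B_5=\frac{A^{*(3)}}{H(q^2-q^{-2})},\quad B_2=\frac{A^{(3)}}{H(q^{-2}-q^{2})},\quad B_4=\frac{A^{(1)}}{H(q^{-2}-q^{2})},\quad B_6=\frac{A^{(2)}}{H(q^{-2}-q^{2})}. \] This $U'_q(\mathfrak{so}_6)$-module is irreducible.
   Context: GRAPH SETTING. $\Gamma=(X,\mathcal R)$ is a finite undirected connected graph without loops or multiple edges, with vertex set $X$, $|X|\ge 2$, path-length distance $\partial$ and diameter $D=\max\{\partial(x,y)\mid x,y\in X\}$. Write $\Gamma_i(x)=\{y\in X\mid\partial(x,y)=i\}$ and $\Gamma(x)=\Gamma_1(x)$. $\Gamma$ is distance-regular: for $0\le h,i,j\le D$ and $\partial(x,y)=h$, the number $p^h_{i,j}=|\Gamma_i(x)\cap\Gamma_j(y)|$ depends only on $h,i,j$. Put $c_i=p^i_{1,i-1}$, $a_i=p^i_{1,i}$, $b_i=p^i_{1,i+1}$ ($c_0=0$, $b_D=0$), $k_i=p^0_{i,i}$. $V$ is the complex vector space with basis $X$. For $0\le i\le D$, $A_i\in\mathrm{End}(V)$ sends $x\mapsto\sum_{\xi\in\Gamma_i(x)}\xi$; $A=A_1$. The $A_i$ form a basis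 of a commutative algebra $M\subseteq\mathrm{End}(V)$ generated by $A$. The primitive idempotents $E_0,\dots,E_D$ are the basis of $M$ with $E_iE_j=\delta_{i,j}E_i$, $\sum_iE_i=I$, $E_0=|X|^{-1}\sum_iA_i$. The Krein parameters $q^h_{i,j}$ are given by $E_i\circ E_j=|X|^{-1}\sum_hq^h_{i,j}E_h$, where $\circ$ is the entrywise product of matrices with respect to the basis $X$. The ordering $E_0,\dots,E_D$ is $Q$-polynomial if for all $0\le h,i,j\le D$: $q^h_{i,j}=0$ when one of $h,i,j$ exceeds the sum of the other two, and $q^h_{i,j}\ne0$ when one of them equals the sum of the other two; $\Gamma$ is $Q$-polynomial if such an ordering exists. $\theta_i$ is defined by $AE_i=\theta_iE_i$, and $\theta^*_i$ by $E_1=|X|^{-1}\sum_{i=0}^D\theta^*_iA_i$. $\Gamma$ is bipartite if $a_i=0$ for all $i$; a bipartite $\Gamma$ is called 2-homogeneous if $k_D=1$ (antipodal 2-cover) and $\Gamma$ is $Q$-polynomial. ASSUMPTION. $D\ge3$, $\Gamma$ is 2-homogeneous bipartite, not a hypercube and not a cycle, and $\{E_i\}_{i=0}^D$ is a fixed $Q$-polynomial ordering. Then there is a nonzero $q\in\mathbb C$, not a root of unity, which we fix, such that for $0\le i\le D$: $\theta_i=\theta^*_i=H\sqrt{-1}\,(q^{D-2i}-q^{2i-D})$, $c_i=H\sqrt{-1}\,\frac{q^{2i}-q^{-2i}}{q^{D-2i}+q^{2i-D}}$, $b_i=H\sqrt{-1}\,\frac{q^{2D-2i}-q^{2i-2D}}{q^{D-2i}+q^{2i-D}}$,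 where $H=\sqrt{-1}\,\frac{q^{D-2}+q^{2-D}}{q^{-2}-q^{2}}$. THE SPACE $\Lambda$ AND THE SIX MAPS. $V^{\otimes3}=V\otimes V\otimes V$. $\mathcal P_D$ is the set of $(r,s,t,u)\in\mathbb N^4$ ($0\in\mathbb N$) with $r+s+t+u=D$. Every $x,y,z\in X$ have a unique profile $(r,s,t,u)\in\mathcal P_D$, determined by $\partial(x,y)=s+t$, $\partial(y,z)=t+u$, $\partial(z,x)=u+s$. For $(r,s,t,u)\in\mathcal P_D$, $B(r,s,t,u)=\sum x\otimes y\otimes z$ over all triples $x,y,z\in X$ of profile $(r,s,t,u)$. $\Lambda$ is the subspace of $V^{\otimes3}$ with basis $\{B(r,s,t,u)\}_{(r,s,t,u)\in\mathcal P_D}$. The maps in $\mathrm{End}(V^{\otimes3})$ are, for $x,y,z\in X$: $A^{(1)}(x\otimes y\otimes z)=\sum_{\xi\in\Gamma(x)}\xi\otimes y\otimes z$, $A^{(2)}(x\otimes y\otimes z)=\sum_{\xi\in\Gamma(y)}x\otimes\xi\otimes z$, $A^{(3)}(x\otimes y\otimes z)=\sum_{\xi\in\Gamma(z)}x\otimes y\otimes\xi$, $A^{*(1)}(x\otimes y\otimes z)=\theta^*_{\partial(y,z)}x\otimes y\otimes z$, $A^{*(2)}(x\otimes y\otimes z)=\theta^*_{\partial(z,x)}x\otimes y\otimes z$, $A^{*(3)}(x\otimes y\otimes z)=\theta^*_{\partial(x,y)}x\otimes y\otimes z$. All six leave $\Lambda$ invariant, and in the claim they denote the restrictions to $\Lambda$.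 THE ALGEBRA $U'_q(\mathfrak{so}_6)$. It is the associative unital complex algebra with generators $B_1,\dots,B_5$ and relations: $B_i^2B_j-(q^2+q^{-2})B_iB_jB_i+B_jB_i^2=-B_j$ if $|i-j|=1$; $B_iB_j=B_jB_i$ if $|i-j|\ge2$. With $[R,S]_q=qRS-q^{-1}SR$, the element $B_6$ is defined by $B_6=-[B_1,[B_2,[B_3,[B_4,B_5]_q]_q]_q]_q$. The displayed formulas in the claim do define a $U'_q(\mathfrak{so}_6)$-module structure on $\Lambda$. *)

theory Defs
  imports
    "HOL-Analysis.Cartesian_Space"
    "HOL-Library.Poly_Mapping"
    "HOL-Algebra.QuotRing"
begin

section \<open>Distance-regular graphs\<close>

text \<open>A graph with vertex set \<open>X = UNIV :: 'v set\<close> (with \<open>'v\<close> finite) is given by its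
  adjacency relation.\<close>

definition gdist :: "('v \<Rightarrow> 'v \<Rightarrow> bool) \<Rightarrow> 'v \<Rightarrow> 'v \<Rightarrow> nat" where
  "gdist adj x y = (LEAST n. (adj ^^ n) x y)"

definition sphere_at :: "('v \<Rightarrow> 'v \<Rightarrow> bool) \<Rightarrow> nat \<Rightarrow> 'v \<Rightarrow> 'v set" where
  "sphere_at adj i x = {y. gdist adj x y = i}"

definition diam :: "('v::finite \<Rightarrow> 'v \<Rightarrow> bool) \<Rightarrow> nat" where
  "diam adj = Max {gdist adj x y | x y. True}"

definition connected_simple_graph :: "('v::finite \<Rightarrow> 'v \<Rightarrow> bool) \<Rightarrow> bool" where
  "connected_simple_graph adj \<longleftrightarrow>
     (\<forall>x y. adj x y \<longrightarrow> adj y x) \<and> (\<forall>x. \<not> adj x x) \<and> (\<forall>x y. adj\<^sup>*\<^sup>* x y) \<and> CARD('v) \<ge> 2"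

definition distance_regular :: "('v::finite \<Rightarrow> 'v \<Rightarrow> bool) \<Rightarrow> bool" where
  "distance_regular adj \<longleftrightarrow>
     connected_simple_graph adj \<and>
     (\<forall>h\<le>diam adj. \<forall>i\<le>diam adj. \<forall>j\<le>diam adj. \<exists>n. \<forall>x y. gdist adj x y = h \<longrightarrow>
        card (sphere_at adj i x \<inter> sphere_at adj j y) = n)"

text \<open>\<open>p\<^sup>h\<^sub>i\<^sub>,\<^sub>j\<close>; meaningful for \<open>h, i, j \<le> D\<close> in a distance-regular graph.\<close>

definition intersection_number :: "('v::finite \<Rightarrow> 'v \<Rightarrow> bool) \<Rightarrow> nat \<Rightarrow> nat \<Rightarrow> nat \<Rightarrow> nat" where
  "intersection_number adj h i j =
     (THE n. \<forall>x y. gdist adj x y = h \<longrightarrow> card (sphere_at adj i x \<inter> sphere_at adj j y) = n)"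

definition c_num :: "('v::finite \<Rightarrow> 'v \<Rightarrow> bool) \<Rightarrow> nat \<Rightarrow> nat" where
  "c_num adj i = (if i = 0 then 0 else intersection_number adj i 1 (i - 1))"

definition a_num :: "('v::finite \<Rightarrow> 'v \<Rightarrow> bool) \<Rightarrow> nat \<Rightarrow> nat" where
  "a_num adj i = intersection_number adj i 1 i"

definition b_num :: "('v::finite \<Rightarrow> 'v \<Rightarrow> bool) \<Rightarrow> nat \<Rightarrow> nat" where
  "b_num adj i = (if i = diam adj then 0 else intersection_number adj i 1 (i + 1))"

definition k_num :: "('v::finite \<Rightarrow> 'v \<Rightarrow> bool) \<Rightarrow> nat \<Rightarrow> nat" where
  "k_num adj i = intersection_number adj 0 i i"

definition bipartite_drg :: "('v::finite \<Rightarrow> 'v \<Rightarrow> bool) \<Rightarrow> bool" where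
  "bipartite_drg adj \<longleftrightarrow> distance_regular adj \<and> (\<forall>i\<le>diam adj. a_num adj i = 0)"

definition is_hypercube :: "('v::finite \<Rightarrow> 'v \<Rightarrow> bool) \<Rightarrow> bool" where
  "is_hypercube adj \<longleftrightarrow> (\<exists>n. \<exists>f :: 'v \<Rightarrow> nat set. bij_betw f UNIV (Pow {..<n}) \<and>
     (\<forall>x y. adj x y \<longleftrightarrow> card ((f x - f y) \<union> (f y - f x)) = 1))"

definition is_cycle :: "('v::finite \<Rightarrow> 'v \<Rightarrow> bool) \<Rightarrow> bool" where
  "is_cycle adj \<longleftrightarrow> (\<exists>n\<ge>3. \<exists>f :: 'v \<Rightarrow> nat. bij_betw f UNIV {..<n} \<and>
     (\<forall>x y. adj x y \<longleftrightarrow> f y = (f x + 1) mod n \<or> f x = (f y + 1) mod n))"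


section \<open>The Bose-Mesner algebra and \<open>Q\<close>-polynomial orderings\<close>

definition msmult :: "complex \<Rightarrow> complex ^ 'n ^ 'm \<Rightarrow> complex ^ 'n ^ 'm" where
  "msmult c M = (\<chi> i j. c * M $ i $ j)"

text \<open>The operation \<open>(*s)\<close> does not provide complex scalar multiplication of matrices, since
  the entries of a matrix viewed as a vector are its rows.\<close>

interpretation cmat: vector_space msmult
  by standard (simp_all add: msmult_def vec_eq_iff algebra_simps)

definition entrywise :: "complex ^ 'n ^ 'm \<Rightarrow> complex ^ 'n ^ 'm \<Rightarrow> complex ^ 'n ^ 'm" where
  "entrywise M N = (\<chi> i j. M $ i $ j * N $ i $ j)"

definition dist_mat :: "('v::finite \<Rightarrow> 'v \<Rightarrow> bool) \<Rightarrow> nat \<Rightarrow> complex ^ 'v ^ 'v" where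
  "dist_mat adj i = (\<chi> y x. if y \<in> sphere_at adj i x then 1 else 0)"

lemma dist_mat_axis: "dist_mat adj i *v axis x 1 = (\<Sum>y\<in>sphere_at adj i x. axis y 1)"
proof -
  have "(\<Sum>j\<in>UNIV. dist_mat adj i $ y $ j * axis x 1 $ j) = dist_mat adj i $ y $ x" for y
    by (subst sum.remove[of _ x]) (auto simp: axis_def intro!: sum.neutral)
  then show ?thesis
    by (simp add: vec_eq_iff matrix_vector_mult_def dist_mat_def axis_def)
qed

definition bose_mesner :: "('v::finite \<Rightarrow> 'v \<Rightarrow> bool) \<Rightarrow> (complex ^ 'v ^ 'v) set" where
  "bose_mesner adj = cmat.span (dist_mat adj ` {..diam adj})"

definition primitive_idempotents ::
    "('v::finite \<Rightarrow> 'v \<Rightarrow> bool) \<Rightarrow> (nat \<Rightarrow> complex ^ 'v ^ 'v) \<Rightarrow> bool" where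
  "primitive_idempotents adj E \<longleftrightarrow>
     inj_on E {..diam adj} \<and>
     cmat.independent (E ` {..diam adj}) \<and>
     cmat.span (E ` {..diam adj}) = bose_mesner adj \<and>
     (\<forall>i\<le>diam adj. \<forall>j\<le>diam adj. E i ** E j = (if i = j then E i else 0)) \<and>
     (\<Sum>i\<le>diam adj. E i) = mat 1 \<and>
     E 0 = msmult (1 / of_nat CARD('v)) (\<Sum>i\<le>diam adj. dist_mat adj i)"

text \<open>\<open>kr h i j\<close> is \<open>q\<^sup>h\<^sub>i\<^sub>,\<^sub>j\<close>. It is uniquely determined for
  \<open>h, i, j \<le> D\<close> because the \<open>E\<^sub>h\<close> are linearly independent.\<close>

definition krein_parameters ::
    "('v::finite \<Rightarrow> 'v \<Rightarrow> bool) \<Rightarrow> (nat \<Rightarrow> complex ^ 'v ^ 'v) \<Rightarrow> (nat \<Rightarrow> nat \<Rightarrow> nat \<Rightarrow> complex) \<Rightarrow> bool"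
  where
  "krein_parameters adj E kr \<longleftrightarrow> (\<forall>i\<le>diam adj. \<forall>j\<le>diam adj.
     entrywise (E i) (E j) =
       msmult (1 / of_nat CARD('v)) (\<Sum>h\<le>diam adj. msmult (kr h i j) (E h)))"

definition Q_polynomial_ordering ::
    "('v::finite \<Rightarrow> 'v \<Rightarrow> bool) \<Rightarrow> (nat \<Rightarrow> complex ^ 'v ^ 'v) \<Rightarrow> bool" where
  "Q_polynomial_ordering adj E \<longleftrightarrow>
     primitive_idempotents adj E \<and>
     (\<exists>kr. krein_parameters adj E kr \<and>
       (\<forall>h\<le>diam adj. \<forall>i\<le>diam adj. \<forall>j\<le>diam adj.
          (h > i + j \<or> i > h + j \<or> j > h + i \<longrightarrow> kr h i j = 0) \<and>
          (h = i + j \<or> i = h + j \<or> j = h + i \<longrightarrow> kr h i j \<noteq> 0)))"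

definition two_homogeneous_bipartite :: "('v::finite \<Rightarrow> 'v \<Rightarrow> bool) \<Rightarrow> bool" where
  "two_homogeneous_bipartite adj \<longleftrightarrow>
     bipartite_drg adj \<and> k_num adj (diam adj) = 1 \<and> (\<exists>E. Q_polynomial_ordering adj E)"

definition eigenvalue_sequence ::
    "('v::finite \<Rightarrow> 'v \<Rightarrow> bool) \<Rightarrow> (nat \<Rightarrow> complex ^ 'v ^ 'v) \<Rightarrow> (nat \<Rightarrow> complex) \<Rightarrow> bool" where
  "eigenvalue_sequence adj E \<theta> \<longleftrightarrow>
     (\<forall>i\<le>diam adj. dist_mat adj 1 ** E i = msmult (\<theta> i) (E i))"

definition dual_eigenvalue_sequence ::
    "('v::finite \<Rightarrow> 'v \<Rightarrow> bool) \<Rightarrow> (nat \<Rightarrow> complex ^ 'v ^ 'v) \<Rightarrow> (nat \<Rightarrow> complex) \<Rightarrow> bool" where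
  "dual_eigenvalue_sequence adj E \<theta>s \<longleftrightarrow>
     E 1 = msmult (1 / of_nat CARD('v)) (\<Sum>i\<le>diam adj. msmult (\<theta>s i) (dist_mat adj i))"


section \<open>The space \<open>\<Lambda>\<close> and the six maps\<close>

text \<open>\<open>V \<otimes> V \<otimes> V\<close> is realised as the coordinate space on \<open>X \<times> X \<times> X\<close>, with
  \<open>tens x y z\<close> in the role of \<open>x \<otimes> y \<otimes> z\<close>.\<close>

type_synonym 'v tens3 = "complex ^ ('v \<times> 'v \<times> 'v)"

definition tens :: "'v::finite \<Rightarrow> 'v \<Rightarrow> 'v \<Rightarrow> 'v tens3" where
  "tens x y z = axis (x, y, z) 1"

definition lin_ext :: "('v::finite \<Rightarrow> 'v \<Rightarrow> 'v \<Rightarrow> 'v tens3) \<Rightarrow> 'v tens3 \<Rightarrow> 'v tens3" where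
  "lin_ext f v = (\<Sum>(x, y, z)\<in>UNIV. (v $ (x, y, z)) *s f x y z)"

lemma lin_ext_tens: "lin_ext f (tens x y z) = f x y z"
proof -
  have "lin_ext f (tens x y z) = (\<Sum>p\<in>UNIV. if p = (x, y, z) then f x y z else 0)"
    unfolding lin_ext_def
    by (rule sum.cong) (auto simp: tens_def axis_def vec_eq_iff split: if_splits)
  then show ?thesis by simp
qed

lemma linear_lin_ext: "Vector_Spaces.linear (*s) (*s) (lin_ext f)"
  by unfold_locales
    (simp_all add: lin_ext_def case_prod_unfold vec.scale_left_distrib vec.scale_sum_right
      sum.distrib vec.scale_right_distrib)

definition A_map1 :: "('v::finite \<Rightarrow> 'v \<Rightarrow> bool) \<Rightarrow> 'v tens3 \<Rightarrow> 'v tens3" where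
  "A_map1 adj = lin_ext (\<lambda>x y z. \<Sum>\<xi>\<in>sphere_at adj 1 x. tens \<xi> y z)"

definition A_map2 :: "('v::finite \<Rightarrow> 'v \<Rightarrow> bool) \<Rightarrow> 'v tens3 \<Rightarrow> 'v tens3" where
  "A_map2 adj = lin_ext (\<lambda>x y z. \<Sum>\<xi>\<in>sphere_at adj 1 y. tens x \<xi> z)"

definition A_map3 :: "('v::finite \<Rightarrow> 'v \<Rightarrow> bool) \<Rightarrow> 'v tens3 \<Rightarrow> 'v tens3" where
  "A_map3 adj = lin_ext (\<lambda>x y z. \<Sum>\<xi>\<in>sphere_at adj 1 z. tens x y \<xi>)"

definition As_map1 :: "('v::finite \<Rightarrow> 'v \<Rightarrow> bool) \<Rightarrow> (nat \<Rightarrow> complex) \<Rightarrow> 'v tens3 \<Rightarrow> 'v tens3" where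
  "As_map1 adj \<theta>s = lin_ext (\<lambda>x y z. \<theta>s (gdist adj y z) *s tens x y z)"

definition As_map2 :: "('v::finite \<Rightarrow> 'v \<Rightarrow> bool) \<Rightarrow> (nat \<Rightarrow> complex) \<Rightarrow> 'v tens3 \<Rightarrow> 'v tens3" where
  "As_map2 adj \<theta>s = lin_ext (\<lambda>x y z. \<theta>s (gdist adj z x) *s tens x y z)"

definition As_map3 :: "('v::finite \<Rightarrow> 'v \<Rightarrow> bool) \<Rightarrow> (nat \<Rightarrow> complex) \<Rightarrow> 'v tens3 \<Rightarrow> 'v tens3" where
  "As_map3 adj \<theta>s = lin_ext (\<lambda>x y z. \<theta>s (gdist adj x y) *s tens x y z)"

definition profiles :: "nat \<Rightarrow> (nat \<times> nat \<times> nat \<times> nat) set" where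
  "profiles D = {(r, s, t, u). r + s + t + u = D}"

definition has_profile ::
    "('v::finite \<Rightarrow> 'v \<Rightarrow> bool) \<Rightarrow> 'v \<Rightarrow> 'v \<Rightarrow> 'v \<Rightarrow> nat \<times> nat \<times> nat \<times> nat \<Rightarrow> bool" where
  "has_profile adj x y z p \<longleftrightarrow> p \<in> profiles (diam adj) \<and>
     (case p of (r, s, t, u) \<Rightarrow>
        gdist adj x y = s + t \<and> gdist adj y z = t + u \<and> gdist adj z x = u + s)"

definition B_vec :: "('v::finite \<Rightarrow> 'v \<Rightarrow> bool) \<Rightarrow> nat \<times> nat \<times> nat \<times> nat \<Rightarrow> 'v tens3" where
  "B_vec adj p = (\<Sum>(x, y, z) | has_profile adj x y z p. tens x y z)"

definition Lambda :: "('v::finite \<Rightarrow> 'v \<Rightarrow> bool) \<Rightarrow> ('v tens3) set" where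
  "Lambda adj = vec.span (B_vec adj ` profiles (diam adj))"


section \<open>The algebra \<open>U'\<^sub>q(so\<^sub>6)\<close>\<close>

subsection \<open>Free associative complex algebras\<close>

text \<open>The free algebra on \<open>'g\<close> is the monoid algebra of the free monoid on \<open>'g\<close>; the free
  monoid is written additively so that multiplication in \<^theory>\<open>HOL-Library.Poly_Mapping\<close>
  is concatenation of words.\<close>

datatype 'g free_monoid = FM (letters: "'g list")

instantiation free_monoid :: (type) monoid_add
begin

definition zero_free_monoid :: "'a free_monoid" where
  "0 = FM []"

definition plus_free_monoid :: "'a free_monoid \<Rightarrow> 'a free_monoid \<Rightarrow> 'a free_monoid" where
  "v + w = FM (letters v @ letters w)"

instance
  by standard (simp_all add: zero_free_monoid_def plus_free_monoid_def)

end

type_synonym 'g free_alg = "'g free_monoid \<Rightarrow>\<^sub>0 complex"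

definition scal :: "complex \<Rightarrow> 'g free_alg" where
  "scal c = Poly_Mapping.single 0 c"

definition gen :: "'g \<Rightarrow> 'g free_alg" where
  "gen g = Poly_Mapping.single (FM [g]) 1"

definition free_ring :: "'g free_alg ring" where
  "free_ring = \<lparr>carrier = UNIV, mult = (*), one = 1, zero = 0, add = (+)\<rparr>"

lemma ring_free_ring: "ring (free_ring :: 'g free_alg ring)"
proof (rule ringI)
  show "abelian_group (free_ring :: 'g free_alg ring)"
  proof (rule abelian_groupI)
    fix x :: "'g free_alg"
    show "\<exists>y\<in>carrier free_ring. y \<oplus>\<^bsub>free_ring\<^esub> x = \<zero>\<^bsub>free_ring\<^esub>"
      by (rule bexI[of _ "- x"]) (simp_all add: free_ring_def)
  qed (simp_all add: free_ring_def algebra_simps)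
  show "monoid (free_ring :: 'g free_alg ring)"
    by (rule monoidI) (simp_all add: free_ring_def algebra_simps)
qed (simp_all add: free_ring_def algebra_simps)

subsection \<open>Presentation by generators and relations\<close>

datatype so6_gen = G1 | G2 | G3 | G4 | G5

fun so6_index :: "so6_gen \<Rightarrow> int" where
  "so6_index G1 = 1"
| "so6_index G2 = 2"
| "so6_index G3 = 3"
| "so6_index G4 = 4"
| "so6_index G5 = 5"

text \<open>The differences of the two sides of the defining relations.\<close>

definition so6_relators :: "complex \<Rightarrow> so6_gen free_alg set" where
  "so6_relators q =
     {gen i * gen i * gen j - scal (q powi 2 + q powi (-2)) * gen i * gen j * gen i
        + gen j * gen i * gen i + gen j | i j. \<bar>so6_index i - so6_index j\<bar> = 1} \<union>
     {gen i * gen j - gen j * gen i | i j. \<bar>so6_index i - so6_index j\<bar> \<ge> 2}"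

definition so6_ideal :: "complex \<Rightarrow> so6_gen free_alg set" where
  "so6_ideal q = genideal free_ring (so6_relators q)"

definition Uq_so6 :: "complex \<Rightarrow> so6_gen free_alg set ring" where
  "Uq_so6 q = FactRing free_ring (so6_ideal q)"

text \<open>The image in \<open>U'\<^sub>q(so\<^sub>6)\<close> of an element of the free algebra.\<close>

definition Uq_class :: "complex \<Rightarrow> so6_gen free_alg \<Rightarrow> so6_gen free_alg set" where
  "Uq_class q a = a_r_coset free_ring (so6_ideal q) a"

lemma ideal_so6_ideal: "ideal (so6_ideal q) free_ring"
  unfolding so6_ideal_def
  by (rule ring.genideal_ideal[OF ring_free_ring]) (simp add: free_ring_def)

lemma ring_Uq_so6: "ring (Uq_so6 q)"
  unfolding Uq_so6_def by (rule ideal.quotient_is_ring[OF ideal_so6_ideal])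

lemma Uq_class_ring_hom: "Uq_class q \<in> ring_hom free_ring (Uq_so6 q)"
  unfolding Uq_so6_def Uq_class_def by (rule ideal.rcos_ring_hom[OF ideal_so6_ideal])

definition qcomm :: "complex \<Rightarrow> 'g free_alg \<Rightarrow> 'g free_alg \<Rightarrow> 'g free_alg" where
  "qcomm q R S = scal q * R * S - scal (inverse q) * S * R"

definition Uq_B :: "complex \<Rightarrow> so6_gen \<Rightarrow> so6_gen free_alg set" where
  "Uq_B q i = Uq_class q (gen i)"

definition Uq_B6 :: "complex \<Rightarrow> so6_gen free_alg set" where
  "Uq_B6 q = Uq_class q
     (- qcomm q (gen G1) (qcomm q (gen G2) (qcomm q (gen G3) (qcomm q (gen G4) (gen G5)))))"

subsection \<open>Modules\<close>

text \<open>Left modules over the complex algebra \<open>U'\<^sub>q(so\<^sub>6)\<close> whose underlying vector space is a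
  subspace \<open>W\<close> of a coordinate space. Complex linearity of each \<open>act a\<close> follows, since scalars
  are central.\<close>

definition so6_module ::
    "complex \<Rightarrow> (so6_gen free_alg set \<Rightarrow> complex ^ 'n \<Rightarrow> complex ^ 'n) \<Rightarrow> (complex ^ 'n) set \<Rightarrow> bool"
  where
  "so6_module q act W \<longleftrightarrow>
     vec.subspace W \<and>
     (\<forall>a\<in>carrier (Uq_so6 q). \<forall>v\<in>W. act a v \<in> W) \<and>
     (\<forall>a\<in>carrier (Uq_so6 q). \<forall>v\<in>W. \<forall>w\<in>W. act a (v + w) = act a v + act a w) \<and>
     (\<forall>a\<in>carrier (Uq_so6 q). \<forall>b\<in>carrier (Uq_so6 q). \<forall>v\<in>W.
        act (a \<oplus>\<^bsub>Uq_so6 q\<^esub> b) v = act a v + act b v \<and>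
        act (a \<otimes>\<^bsub>Uq_so6 q\<^esub> b) v = act a (act b v)) \<and>
     (\<forall>v\<in>W. act \<one>\<^bsub>Uq_so6 q\<^esub> v = v) \<and>
     (\<forall>c. \<forall>v\<in>W. act (Uq_class q (scal c)) v = c *s v)"

definition so6_irreducible ::
    "complex \<Rightarrow> (so6_gen free_alg set \<Rightarrow> complex ^ 'n \<Rightarrow> complex ^ 'n) \<Rightarrow> (complex ^ 'n) set \<Rightarrow> bool"
  where
  "so6_irreducible q act W \<longleftrightarrow>
     so6_module q act W \<and> W \<noteq> {0} \<and>
     (\<forall>W'. W' \<subseteq> W \<and> so6_module q act W' \<longrightarrow> W' = {0} \<or> W' = W)"

end

theory Submission
  imports Defs
begin

text \<open>
  Let \<open>W\<close> be a nonzero submodule of \<open>\<Lambda>\<close>. The elements \<open>B\<^sub>1, \<dots>, B\<^sub>6\<close> act as nonzero multiples of the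
  six maps, so \<open>W\<close> is invariant under \<open>A\<^sup>(\<^sup>i\<^sup>)\<close> and \<open>A\<^sup>*\<^sup>(\<^sup>i\<^sup>)\<close>.

  In the coordinates indexed by triples of vertices, \<open>A\<^sup>*\<^sup>(\<^sup>1\<^sup>)\<close>, \<open>A\<^sup>*\<^sup>(\<^sup>2\<^sup>)\<close>, \<open>A\<^sup>*\<^sup>(\<^sup>3\<^sup>)\<close> are diagonal, with entries
  \<open>\<theta>\<^sup>*\<close> of the three distances in the triple. Since \<open>q\<close> is not a root of unity, the \<open>\<theta>\<^sup>*\<^sub>i\<close> are distinct.
  The three distances determine the profile, so \<open>W\<close> is closed under restriction of vectors to the triples
  of a given profile (\<open>subspace_restrict_level_set\<close>). A vector of \<open>\<Lambda>\<close> is constant on these triples.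
  Hence \<open>W\<close> contains \<open>B(p)\<close> as soon as some vector of \<open>W\<close> has a nonzero coordinate at a triple
  of profile \<open>p\<close> (\<open>B_vec_mem_of_nonzero_coordinate\<close>).

  The maps \<open>A\<^sup>(\<^sup>i\<^sup>)\<close> move one vertex of a triple to a neighbour. The coordinates of \<open>A\<^sup>(\<^sup>i\<^sup>) B(p)\<close> are
  numbers of neighbouring triples of profile \<open>p\<close>, so nothing cancels: the triples whose profile \<open>p\<close>
  satisfies \<open>B(p) \<in> W\<close> form a set closed under moving one vertex to a neighbour. As the graph
  is connected, every triple is reached, and \<open>W\<close> contains all \<open>B(p)\<close>
  (\<open>invariant_subspace_eq_Lambda\<close>).
\<close>

section \<open>Diagonal maps and restriction to level sets\<close>

definition pointwise_mult :: "('n \<Rightarrow> complex) \<Rightarrow> complex ^ 'n \<Rightarrow> complex ^ 'n" where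
  "pointwise_mult g v = (\<chi> i. g i * v $ i)"

text \<open>Lagrange interpolation: the indicator of a level set of \<open>g\<close> is a polynomial in \<open>g\<close>.\<close>

lemma subspace_restrict_level_set:
  fixes W :: "(complex ^ 'n::finite) set"
  assumes W: "vec.subspace W"
    and inv: "\<And>v. v \<in> W \<Longrightarrow> pointwise_mult g v \<in> W"
    and v: "v \<in> W"
  shows "pointwise_mult (\<lambda>i. if g i = a then 1 else 0) v \<in> W"
proof -
  let ?P = "\<lambda>S i. \<Prod>b\<in>S. (g i - b) / (a - b)"
  \<comment> \<open>For \<open>a \<in> S\<close> the factor with \<open>b = a\<close> has denominator \<open>0\<close>, so that the product is \<open>0\<close>;
    the claim is then trivial, and the induction can run over all finite sets.\<close>
  have "pointwise_mult (?P S) v \<in> W" if "finite S" for S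
    using that
  proof (induction S)
    case empty
    then show ?case using v by (simp add: pointwise_mult_def vec_lambda_eta)
  next
    case (insert b S)
    let ?u = "pointwise_mult (?P S) v"
    have "pointwise_mult (?P (insert b S)) v = (1 / (a - b)) *s (pointwise_mult g ?u - b *s ?u)"
      using insert.hyps
      by (simp add: pointwise_mult_def vec_eq_iff left_diff_distrib[symmetric] mult.assoc)
    also have "\<dots> \<in> W"
      using insert.IH inv by (intro vec.subspace_scale vec.subspace_diff W) auto
    finally show ?case .
  qed
  then have "pointwise_mult (?P (range g - {a})) v \<in> W"
    by simp
  moreover have "?P (range g - {a}) = (\<lambda>i. if g i = a then 1 else 0)"
  proof
    fix i
    show "?P (range g - {a}) i = (if g i = a then 1 else 0)"
      by (auto intro!: prod.neutral)
  qed
  ultimately show ?thesis by simp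
qed

section \<open>The six maps in coordinates\<close>

lemma lin_ext_nth: "lin_ext f v $ \<tau> = (\<Sum>(x, y, z)\<in>UNIV. v $ (x, y, z) * f x y z $ \<tau>)"
  unfolding lin_ext_def by (simp add: case_prod_unfold)

lemma lin_ext_diagonal:
  "lin_ext (\<lambda>x y z. g (x, y, z) *s tens x y z) v = pointwise_mult g v"
proof -
  have "lin_ext (\<lambda>x y z. g (x, y, z) *s tens x y z) v $ \<tau> = g \<tau> * v $ \<tau>" for \<tau>
  proof -
    have "lin_ext (\<lambda>x y z. g (x, y, z) *s tens x y z) v $ \<tau>
        = (\<Sum>\<sigma>\<in>UNIV. if \<sigma> = \<tau> then g \<tau> * v $ \<tau> else 0)"
      unfolding lin_ext_nth
      by (rule sum.cong) (auto simp: tens_def axis_def)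
    then show ?thesis by simp
  qed
  then show ?thesis by (simp add: pointwise_mult_def vec_eq_iff)
qed

lemma As_map_eq_pointwise_mult:
  "As_map1 adj \<theta>s = pointwise_mult (\<lambda>(x, y, z). \<theta>s (gdist adj y z))"
  "As_map2 adj \<theta>s = pointwise_mult (\<lambda>(x, y, z). \<theta>s (gdist adj z x))"
  "As_map3 adj \<theta>s = pointwise_mult (\<lambda>(x, y, z). \<theta>s (gdist adj x y))"
  unfolding As_map1_def As_map2_def As_map3_def
  using lin_ext_diagonal[of "\<lambda>(x, y, z). \<theta>s (gdist adj y z)"]
    lin_ext_diagonal[of "\<lambda>(x, y, z). \<theta>s (gdist adj z x)"]
    lin_ext_diagonal[of "\<lambda>(x, y, z). \<theta>s (gdist adj x y)"]
  by (simp_all add: fun_eq_iff)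

lemma lin_ext_sum_axis_nth:
  assumes "\<And>x y z. f x y z = (\<Sum>\<rho>\<in>N (x, y, z). axis \<rho> 1)"
  shows "lin_ext f v $ \<tau> = (\<Sum>\<sigma> | \<tau> \<in> N \<sigma>. v $ \<sigma>)"
proof -
  have "f x y z $ \<tau> = (if \<tau> \<in> N (x, y, z) then 1 else 0)" for x y z
    by (simp add: assms axis_def)
  then have "lin_ext f v $ \<tau> = (\<Sum>\<sigma>\<in>UNIV. if \<tau> \<in> N \<sigma> then v $ \<sigma> else 0)"
    unfolding lin_ext_nth by (intro sum.cong) auto
  then show ?thesis by (simp add: sum.If_cases)
qed

lemma A_map1_nth:
  "A_map1 adj v $ \<tau> = (\<Sum>\<sigma> | \<exists>x y z \<xi>. \<sigma> = (x, y, z) \<and> \<tau> = (\<xi>, y, z) \<and> \<xi> \<in> sphere_at adj 1 x. v $ \<sigma>)"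
proof -
  have "A_map1 adj v $ \<tau> = (\<Sum>\<sigma> | \<tau> \<in> (\<lambda>(x, y, z). (\<lambda>\<xi>. (\<xi>, y, z)) ` sphere_at adj 1 x) \<sigma>. v $ \<sigma>)"
    unfolding A_map1_def
    by (rule lin_ext_sum_axis_nth) (simp add: tens_def sum.reindex inj_on_def)
  also have "\<dots> = (\<Sum>\<sigma> | \<exists>x y z \<xi>. \<sigma> = (x, y, z) \<and> \<tau> = (\<xi>, y, z) \<and> \<xi> \<in> sphere_at adj 1 x. v $ \<sigma>)"
    by (rule sum.cong) auto
  finally show ?thesis .
qed

lemma A_map2_nth:
  "A_map2 adj v $ \<tau> = (\<Sum>\<sigma> | \<exists>x y z \<xi>. \<sigma> = (x, y, z) \<and> \<tau> = (x, \<xi>, z) \<and> \<xi> \<in> sphere_at adj 1 y. v $ \<sigma>)"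
proof -
  have "A_map2 adj v $ \<tau> = (\<Sum>\<sigma> | \<tau> \<in> (\<lambda>(x, y, z). (\<lambda>\<xi>. (x, \<xi>, z)) ` sphere_at adj 1 y) \<sigma>. v $ \<sigma>)"
    unfolding A_map2_def
    by (rule lin_ext_sum_axis_nth) (simp add: tens_def sum.reindex inj_on_def)
  also have "\<dots> = (\<Sum>\<sigma> | \<exists>x y z \<xi>. \<sigma> = (x, y, z) \<and> \<tau> = (x, \<xi>, z) \<and> \<xi> \<in> sphere_at adj 1 y. v $ \<sigma>)"
    by (rule sum.cong) auto
  finally show ?thesis .
qed

lemma A_map3_nth:
  "A_map3 adj v $ \<tau> = (\<Sum>\<sigma> | \<exists>x y z \<xi>. \<sigma> = (x, y, z) \<and> \<tau> = (x, y, \<xi>) \<and> \<xi> \<in> sphere_at adj 1 z. v $ \<sigma>)"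
proof -
  have "A_map3 adj v $ \<tau> = (\<Sum>\<sigma> | \<tau> \<in> (\<lambda>(x, y, z). (\<lambda>\<xi>. (x, y, \<xi>)) ` sphere_at adj 1 z) \<sigma>. v $ \<sigma>)"
    unfolding A_map3_def
    by (rule lin_ext_sum_axis_nth) (simp add: tens_def sum.reindex inj_on_def)
  also have "\<dots> = (\<Sum>\<sigma> | \<exists>x y z \<xi>. \<sigma> = (x, y, z) \<and> \<tau> = (x, y, \<xi>) \<and> \<xi> \<in> sphere_at adj 1 z. v $ \<sigma>)"
    by (rule sum.cong) auto
  finally show ?thesis .
qed

section \<open>Profiles and the space \<open>\<Lambda>\<close>\<close>

lemma gdist_le_diam: "gdist adj x y \<le> diam adj"
proof -
  have "{gdist adj x y | x y. True} = range (\<lambda>(x, y). gdist adj x y)"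
    by auto
  then have "finite {gdist adj x y | x y. True}"
    by simp
  then show ?thesis
    unfolding diam_def by (rule Max_ge) auto
qed

lemma gdist_self: "gdist adj x x = 0"
  unfolding gdist_def by (rule Least_eq_0) simp

lemma neighbour_in_sphere:
  assumes "connected_simple_graph adj" "adj x y"
  shows "y \<in> sphere_at adj 1 x"
proof -
  have "x \<noteq> y"
    using assms by (auto simp: connected_simple_graph_def)
  then have "gdist adj x y = 1"
    unfolding gdist_def
  proof (intro Least_equality)
    show "(adj ^^ 1) x y"
      using assms(2) by (simp only: relpowp_1)
    show "1 \<le> n" if "(adj ^^ n) x y" for n
      using that \<open>x \<noteq> y\<close> by (cases n) auto
  qed
  then show ?thesis by (simp add: sphere_at_def)
qed

lemma has_profile_unique:
  assumes "has_profile adj x y z p" "has_profile adj x y z p'"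
  shows "p = p'"
proof -
  obtain r s t u r' s' t' u' where p: "p = (r, s, t, u)" "p' = (r', s', t', u')"
    by (metis prod_cases4)
  have "s + t = s' + t'" "t + u = t' + u'" "u + s = u' + s'" "r + s + t + u = r' + s' + t' + u'"
    using assms unfolding p has_profile_def profiles_def by simp_all
  then have "s = s'" "t = t'" "u = u'" "r = r'"
    by linarith+
  then show ?thesis by (simp add: p)
qed

lemma has_profile_iff_same_distances:
  assumes "has_profile adj x y z p"
  shows "has_profile adj x' y' z' p \<longleftrightarrow>
    gdist adj y' z' = gdist adj y z \<and> gdist adj z' x' = gdist adj z x \<and>
    gdist adj x' y' = gdist adj x y"
proof -
  obtain r s t u where p: "p = (r, s, t, u)"
    by (metis prod_cases4)
  show ?thesis
    using assms unfolding p has_profile_def prod.case by metis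
qed

lemma B_vec_nth: "B_vec adj p $ (x, y, z) = (if has_profile adj x y z p then 1 else 0)"
proof -
  have "B_vec adj p $ (x, y, z)
      = (\<Sum>\<sigma> | case \<sigma> of (a, b, c) \<Rightarrow> has_profile adj a b c p. if \<sigma> = (x, y, z) then 1 else 0)"
    unfolding B_vec_def sum_component
    by (intro sum.cong) (auto simp: tens_def axis_def split: if_splits)
  then show ?thesis by (simp add: sum.delta)
qed

text \<open>The vectors of \<open>\<Lambda>\<close> vanish at every triple without a profile. For a submodule this
  makes it possible to conclude that a triple has a profile from a nonzero coordinate.\<close>

lemma Lambda_nth_nonzero_has_profile:
  assumes "v \<in> Lambda adj" "v $ (x, y, z) \<noteq> 0"
  shows "\<exists>p\<in>profiles (diam adj). has_profile adj x y z p"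
proof (rule ccontr)
  assume none: "\<not> ?thesis"
  have "v \<in> {v. v $ (x, y, z) = 0}"
    using assms(1) unfolding Lambda_def
    by (rule vec.span_induct)
      (use none in \<open>auto simp: vec.subspace_def B_vec_nth\<close>)
  then show False using assms(2) by simp
qed

lemma Lambda_nth_eq_if_same_profile:
  assumes "v \<in> Lambda adj" "has_profile adj x y z p" "has_profile adj x' y' z' p"
  shows "v $ (x', y', z') = v $ (x, y, z)"
proof -
  have "B_vec adj p' $ (x', y', z') = B_vec adj p' $ (x, y, z)" for p'
    using has_profile_unique[OF assms(2), of p'] has_profile_unique[OF assms(3), of p'] assms(2,3)
    by (auto simp: B_vec_nth)
  then have "Lambda adj \<subseteq> {v. v $ (x', y', z') = v $ (x, y, z)}"
    unfolding Lambda_def by (intro vec.span_minimal) (auto simp: vec.subspace_def)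
  with assms(1) show ?thesis by blast
qed

lemma Lambda_nonzero: "Lambda (adj :: 'v::finite \<Rightarrow> 'v \<Rightarrow> bool) \<noteq> {0}"
proof
  assume zero: "Lambda adj = {0}"
  let ?p = "(diam adj, 0, 0, 0)"
  have "?p \<in> profiles (diam adj)"
    by (simp add: profiles_def)
  then have "B_vec adj ?p \<in> Lambda adj" and "has_profile adj x x x ?p" for x
    by (auto simp: Lambda_def has_profile_def gdist_self intro: vec.span_base)
  then have "B_vec adj ?p = 0" and "B_vec adj ?p $ (x, x, x) = 1" for x
    using zero by (auto simp only: B_vec_nth if_True)
  then show False by simp
qed

section \<open>Invariant subspaces of \<open>\<Lambda>\<close>\<close>

text \<open>The joint eigenspaces of the three maps \<open>A\<^sup>*\<^sup>(\<^sup>i\<^sup>)\<close> on \<open>\<Lambda>\<close> are the lines spanned by the nonzero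
  vectors \<open>B(p)\<close>. The component of \<open>v\<close> in the line of the profile \<open>p\<close> of \<open>(x, y, z)\<close> is the
  coordinate of \<open>v\<close> at \<open>(x, y, z)\<close> times \<open>B(p)\<close>.\<close>

lemma B_vec_mem_of_nonzero_coordinate:
  assumes inj: "inj_on \<theta>s {..diam adj}"
    and W: "vec.subspace W" "W \<subseteq> Lambda adj"
    and As: "\<And>v. v \<in> W \<Longrightarrow> As_map1 adj \<theta>s v \<in> W"
      "\<And>v. v \<in> W \<Longrightarrow> As_map2 adj \<theta>s v \<in> W"
      "\<And>v. v \<in> W \<Longrightarrow> As_map3 adj \<theta>s v \<in> W"
    and v: "v \<in> W" "v $ (x, y, z) \<noteq> 0"
  obtains p where "p \<in> profiles (diam adj)" "has_profile adj x y z p" "B_vec adj p \<in> W"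
proof -
  obtain p where p: "p \<in> profiles (diam adj)" "has_profile adj x y z p"
    using Lambda_nth_nonzero_has_profile W(2) v by blast
  let ?g1 = "\<lambda>(x, y, z). \<theta>s (gdist adj y z)"
  let ?g2 = "\<lambda>(x, y, z). \<theta>s (gdist adj z x)"
  let ?g3 = "\<lambda>(x, y, z). \<theta>s (gdist adj x y)"
  let ?R = "\<lambda>g. pointwise_mult (\<lambda>\<sigma>. if g \<sigma> = g (x, y, z) then 1 else 0)"
  have "?R ?g1 (?R ?g2 (?R ?g3 v)) \<in> W"
    by (intro subspace_restrict_level_set W(1) v(1))
      (use As in \<open>simp_all add: As_map_eq_pointwise_mult\<close>)
  moreover have "?R ?g1 (?R ?g2 (?R ?g3 v)) = v $ (x, y, z) *s B_vec adj p"
  proof -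
    have eq: "\<theta>s (gdist adj a b) = \<theta>s (gdist adj c d) \<longleftrightarrow> gdist adj a b = gdist adj c d"
      for a b c d
      by (rule inj_on_eq_iff[OF inj]) (simp_all add: gdist_le_diam)
    have "?R ?g1 (?R ?g2 (?R ?g3 v)) $ (x', y', z') = v $ (x, y, z) * B_vec adj p $ (x', y', z')"
      for x' y' z'
    proof (cases "has_profile adj x' y' z' p")
      case True
      then have "v $ (x', y', z') = v $ (x, y, z)"
        using Lambda_nth_eq_if_same_profile p(2) W(2) v(1) by blast
      with True show ?thesis
        using True[unfolded has_profile_iff_same_distances[OF p(2)]]
        by (simp add: pointwise_mult_def B_vec_nth)
    next
      case False
      then show ?thesis
        using False[unfolded has_profile_iff_same_distances[OF p(2)]]
        by (auto simp: pointwise_mult_def B_vec_nth eq)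
    qed
    then show ?thesis
      unfolding vec_eq_iff vector_smult_component split_paired_All by blast
  qed
  ultimately have "v $ (x, y, z) *s B_vec adj p \<in> W"
    by (simp only:)
  then have "(1 / v $ (x, y, z)) *s (v $ (x, y, z) *s B_vec adj p) \<in> W"
    by (rule vec.subspace_scale[OF W(1)])
  then have "B_vec adj p \<in> W"
    using v(2) by simp
  with p that show thesis by blast
qed

text \<open>As the graph is connected, any two triples are joined by a walk that moves one vertex at
  a time to a neighbour. Such a walk carries membership of \<open>B(p)\<close> in \<open>W\<close> from profile to
  profile. That every triple met on the way has a profile follows from the invariance of
  \<open>W \<subseteq> \<Lambda>\<close>.\<close>

lemma invariant_subspace_eq_Lambda:
  fixes adj :: "'v::finite \<Rightarrow> 'v \<Rightarrow> bool"
  assumes graph: "connected_simple_graph adj"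
    and inj: "inj_on \<theta>s {..diam adj}"
    and W: "vec.subspace W" "W \<subseteq> Lambda adj" "W \<noteq> {0}"
    and As: "\<And>v. v \<in> W \<Longrightarrow> As_map1 adj \<theta>s v \<in> W"
      "\<And>v. v \<in> W \<Longrightarrow> As_map2 adj \<theta>s v \<in> W"
      "\<And>v. v \<in> W \<Longrightarrow> As_map3 adj \<theta>s v \<in> W"
    and A: "\<And>v. v \<in> W \<Longrightarrow> A_map1 adj v \<in> W"
      "\<And>v. v \<in> W \<Longrightarrow> A_map2 adj v \<in> W"
      "\<And>v. v \<in> W \<Longrightarrow> A_map3 adj v \<in> W"
  shows "W = Lambda adj"
proof -
  define T where "T x y z \<longleftrightarrow> (\<exists>p. has_profile adj x y z p \<and> B_vec adj p \<in> W)" for x y z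
  have T_if_nonzero: "T x y z" if "v \<in> W" "v $ (x, y, z) \<noteq> 0" for v x y z
    using B_vec_mem_of_nonzero_coordinate[OF inj W(1,2) As that] T_def by metis
  have conn: "adj\<^sup>*\<^sup>* x y" for x y
    using graph by (simp add: connected_simple_graph_def)
  \<comment> \<open>The coordinates of \<open>B(p)\<close> are \<open>0\<close> and \<open>1\<close>, so their sum over \<open>S\<close> is a cardinality.\<close>
  have count_nonzero: "(\<Sum>\<sigma>\<in>S. B_vec adj p $ \<sigma>) \<noteq> 0"
    if "has_profile adj x y z p" "(x, y, z) \<in> S" for x y z p S
  proof -
    have "(\<Sum>\<sigma>\<in>S. B_vec adj p $ \<sigma>)
        = of_nat (card {(x, y, z) \<in> S. has_profile adj x y z p})"
    proof -
      have "(\<Sum>\<sigma>\<in>S. B_vec adj p $ \<sigma>)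
          = (\<Sum>\<sigma>\<in>S. if case \<sigma> of (x, y, z) \<Rightarrow> has_profile adj x y z p then 1 else 0)"
        by (intro sum.cong) (auto simp: B_vec_nth)
      also have "\<dots> = of_nat (card {\<sigma> \<in> S. case \<sigma> of (x, y, z) \<Rightarrow> has_profile adj x y z p})"
        by (simp add: sum.If_cases Int_def)
      finally show ?thesis by (simp add: case_prod_unfold)
    qed
    moreover have "(x, y, z) \<in> {(x, y, z) \<in> S. has_profile adj x y z p}"
      using that by simp
    ultimately show ?thesis by auto
  qed
  have step1: "T \<xi> y z" if "T x y z" "adj x \<xi>" for x \<xi> y z
  proof -
    obtain p where p: "has_profile adj x y z p" "B_vec adj p \<in> W"
      using \<open>T x y z\<close> T_def by blast
    have "A_map1 adj (B_vec adj p) $ (\<xi>, y, z) \<noteq> 0"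
      unfolding A_map1_nth
      by (rule count_nonzero[OF p(1)]) (use neighbour_in_sphere[OF graph that(2)] in auto)
    with T_if_nonzero A(1)[OF p(2)] show ?thesis by blast
  qed
  have step2: "T x \<xi> z" if "T x y z" "adj y \<xi>" for x y \<xi> z
  proof -
    obtain p where p: "has_profile adj x y z p" "B_vec adj p \<in> W"
      using \<open>T x y z\<close> T_def by blast
    have "A_map2 adj (B_vec adj p) $ (x, \<xi>, z) \<noteq> 0"
      unfolding A_map2_nth
      by (rule count_nonzero[OF p(1)]) (use neighbour_in_sphere[OF graph that(2)] in auto)
    with T_if_nonzero A(2)[OF p(2)] show ?thesis by blast
  qed
  have step3: "T x y \<xi>" if "T x y z" "adj z \<xi>" for x y z \<xi>
  proof -
    obtain p where p: "has_profile adj x y z p" "B_vec adj p \<in> W"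
      using \<open>T x y z\<close> T_def by blast
    have "A_map3 adj (B_vec adj p) $ (x, y, \<xi>) \<noteq> 0"
      unfolding A_map3_nth
      by (rule count_nonzero[OF p(1)]) (use neighbour_in_sphere[OF graph that(2)] in auto)
    with T_if_nonzero A(3)[OF p(2)] show ?thesis by blast
  qed
  obtain v where "v \<in> W" "v \<noteq> 0"
    using W(1,3) vec.subspace_0 by blast
  then obtain x0 y0 z0 where "v $ (x0, y0, z0) \<noteq> 0"
    by (auto simp: vec_eq_iff)
  with \<open>v \<in> W\<close> have start: "T x0 y0 z0"
    by (rule T_if_nonzero)
  have T_all: "T x y z" for x y z
  proof -
    have "T x y0 z0"
      using conn[of x0 x] by induction (use start step1 in auto)
    then have "T x y z0"
      by (rule rtranclp_induct[OF conn[of y0 y]]) (use step2 in auto)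
    then show ?thesis
      by (rule rtranclp_induct[OF conn[of z0 z]]) (use step3 in auto)
  qed
  have "B_vec adj p \<in> W" for p
  proof (cases "\<exists>x y z. has_profile adj x y z p")
    case True
    then obtain x y z where "has_profile adj x y z p" by blast
    with T_all[of x y z] show ?thesis
      unfolding T_def using has_profile_unique by metis
  next
    case False
    then have "B_vec adj p = 0"
      by (auto simp: vec_eq_iff B_vec_nth)
    then show ?thesis using W(1) by (simp add: vec.subspace_0)
  qed
  then have "Lambda adj \<subseteq> W"
    unfolding Lambda_def by (intro vec.span_minimal W(1)) auto
  with W(2) show ?thesis by blast
qed

section \<open>Consequences of \<open>q\<close> not being a root of unity\<close>

lemma powi_eq_1_imp_zero:
  fixes q :: complex
  assumes "\<forall>n>0. q ^ n \<noteq> 1" "q powi k = 1"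
  shows "k = 0"
proof (rule ccontr)
  assume "k \<noteq> 0"
  have "q ^ nat \<bar>k\<bar> = 1"
    using assms(2) by (cases "k \<ge> 0") (auto simp: power_int_def power_inverse)
  with assms(1) \<open>k \<noteq> 0\<close> show False by auto
qed

lemma powi_neq_minus_1:
  fixes q :: complex
  assumes "\<forall>n>0. q ^ n \<noteq> 1"
  shows "q powi k \<noteq> -1"
proof
  assume k: "q powi k = -1"
  then have "q powi (k * 2) = 1"
    by (simp add: power_int_mult)
  with assms have "k = 0"
    using powi_eq_1_imp_zero[of q "k * 2"] by simp
  with k show False by simp
qed

text \<open>The function \<open>t - t\<^sup>-\<^sup>1\<close> takes the same value at \<open>t\<close> and \<open>t'\<close> only if \<open>t = t'\<close>
  or \<open>t t' = -1\<close>, and no power of \<open>q\<close> is \<open>-1\<close>. This separates the dual eigenvalues.\<close>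

lemma powi_minus_inverse_inj:
  fixes q :: complex
  assumes "q \<noteq> 0" "\<forall>n>0. q ^ n \<noteq> 1"
    and eq: "q powi m - q powi (- m) = q powi n - q powi (- n)"
  shows "m = n"
proof -
  have "q powi (m + n) * (q powi m - q powi (- m) - (q powi n - q powi (- n))) = 0"
    using eq by simp
  also have "q powi (m + n) * (q powi m - q powi (- m) - (q powi n - q powi (- n)))
      = (q powi m - q powi n) * (q powi (m + n) + 1)"
    using assms(1) by (simp add: power_int_add power_int_minus field_simps)
  finally have "q powi m = q powi n"
    using powi_neq_minus_1[OF assms(2), of "m + n"] by (auto simp: add_eq_0_iff2)
  then have "q powi (m - n) = 1"
    using assms(1) by (simp add: power_int_diff)
  then show ?thesis
    using powi_eq_1_imp_zero[OF assms(2)] by fastforce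
qed

section \<open>Submodules and irreducibility\<close>

lemma Uq_class_in_carrier: "Uq_class q a \<in> carrier (Uq_so6 q)"
  by (rule ring_hom_closed[OF Uq_class_ring_hom]) (simp add: free_ring_def)

lemma so6_submodule_invariant:
  assumes W: "so6_module q act W" "W \<subseteq> L"
    and T: "\<forall>v\<in>L. act (Uq_class q a) v = (1 / k) *s T v"
    and k: "k \<noteq> 0" and v: "v \<in> W"
  shows "T v \<in> W"
proof -
  have "act (Uq_class q a) v \<in> W"
    using W(1) v Uq_class_in_carrier unfolding so6_module_def by blast
  then have "(1 / k) *s T v \<in> W"
    using W(2) T v by auto
  moreover have "vec.subspace W"
    using W(1) unfolding so6_module_def by blast
  ultimately have "k *s ((1 / k) *s T v) \<in> W"
    by (rule vec.subspace_scale[rotated])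
  then show ?thesis using k by simp
qed

theorem lemma10p20:
  fixes adj :: "'v::finite \<Rightarrow> 'v \<Rightarrow> bool"
    and D :: nat
    and E :: "nat \<Rightarrow> complex ^ 'v ^ 'v"
    and \<theta> \<theta>s :: "nat \<Rightarrow> complex"
    and q H :: complex
    and act :: "so6_gen free_alg set \<Rightarrow> 'v tens3 \<Rightarrow> 'v tens3"
  assumes D_def: "D = diam adj"
    and D_ge: "D \<ge> 3"
    and two_hom: "two_homogeneous_bipartite adj"
    and not_cube: "\<not> is_hypercube adj"
    and not_cycle: "\<not> is_cycle adj"
    and Qpoly: "Q_polynomial_ordering adj E"
    and eig: "eigenvalue_sequence adj E \<theta>"
    and dual_eig: "dual_eigenvalue_sequence adj E \<theta>s"
    and q_nonzero: "q \<noteq> 0"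
    and q_not_root: "\<forall>n>0. q ^ n \<noteq> 1"
    and H_def: "H = \<i> * (q powi (int D - 2) + q powi (2 - int D)) / (q powi (-2) - q powi 2)"
    and theta: "\<forall>i\<le>D. \<theta> i = H * \<i> * (q powi (int D - 2 * int i) - q powi (2 * int i - int D))"
    and theta_dual: "\<forall>i\<le>D. \<theta>s i = \<theta> i"
    and c_formula: "\<forall>i\<le>D. of_nat (c_num adj i) =
      H * \<i> * (q powi (2 * int i) - q powi (- 2 * int i)) /
        (q powi (int D - 2 * int i) + q powi (2 * int i - int D))"
    and b_formula: "\<forall>i\<le>D. of_nat (b_num adj i) =
      H * \<i> * (q powi (2 * int D - 2 * int i) - q powi (2 * int i - 2 * int D)) /
        (q powi (int D - 2 * int i) + q powi (2 * int i - int D))"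
    and module: "so6_module q act (Lambda adj)"
    and B1: "\<forall>v\<in>Lambda adj. act (Uq_B q G1) v = (1 / (H * (q powi 2 - q powi (-2)))) *s As_map1 adj \<theta>s v"
    and B3: "\<forall>v\<in>Lambda adj. act (Uq_B q G3) v = (1 / (H * (q powi 2 - q powi (-2)))) *s As_map2 adj \<theta>s v"
    and B5: "\<forall>v\<in>Lambda adj. act (Uq_B q G5) v = (1 / (H * (q powi 2 - q powi (-2)))) *s As_map3 adj \<theta>s v"
    and B2: "\<forall>v\<in>Lambda adj. act (Uq_B q G2) v = (1 / (H * (q powi (-2) - q powi 2))) *s A_map3 adj v"
    and B4: "\<forall>v\<in>Lambda adj. act (Uq_B q G4) v = (1 / (H * (q powi (-2) - q powi 2))) *s A_map1 adj v"
    and B6: "\<forall>v\<in>Lambda adj. act (Uq_B6 q) v = (1 / (H * (q powi (-2) - q powi 2))) *s A_map2 adj v"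
  shows "so6_irreducible q act (Lambda adj)"
proof -
  have graph: "connected_simple_graph adj"
    using two_hom
    by (simp add: two_homogeneous_bipartite_def bipartite_drg_def distance_regular_def)
  have neq: "q powi m \<noteq> q powi (- m)" if "m \<noteq> 0" for m
  proof
    assume "q powi m = q powi (- m)"
    then have "q powi m - q powi (- m) = q powi 0 - q powi (- 0)"
      by simp
    from powi_minus_inverse_inj[OF q_nonzero q_not_root this] that show False by simp
  qed
  have "q powi (int D - 2) + q powi (2 - int D) \<noteq> 0"
  proof
    assume "q powi (int D - 2) + q powi (2 - int D) = 0"
    then have "q powi (int D - 2) = - (q powi (2 - int D))"
      by (simp add: add_eq_0_iff2)
    then have "q powi (int D - 2) / q powi (2 - int D) = -1"
      using q_nonzero by simp
    then have "q powi (int D - 2 - (2 - int D)) = -1"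
      by (simp only: power_int_diff[OF disjI1[OF q_nonzero]])
    with powi_neq_minus_1[OF q_not_root] show False by blast
  qed
  then have H: "H \<noteq> 0"
    using neq[of 2] by (simp add: H_def)
  have k: "H * (q powi 2 - q powi (-2)) \<noteq> 0" "H * (q powi (-2) - q powi 2) \<noteq> 0"
    using H neq[of 2] by auto
  have inj: "inj_on \<theta>s {..diam adj}"
  proof (rule inj_onI)
    fix i j assume ij: "i \<in> {..diam adj}" "j \<in> {..diam adj}" "\<theta>s i = \<theta>s j"
    have "\<theta>s l = H * \<i> * (q powi (int D - 2 * int l) - q powi (- (int D - 2 * int l)))"
      if "l \<le> D" for l
      using theta theta_dual that by simp
    with ij H have "q powi (int D - 2 * int i) - q powi (- (int D - 2 * int i))
        = q powi (int D - 2 * int j) - q powi (- (int D - 2 * int j))"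
      by (simp add: D_def)
    from powi_minus_inverse_inj[OF q_nonzero q_not_root this] show "i = j" by simp
  qed
  have "W' = Lambda adj"
    if W': "W' \<subseteq> Lambda adj" "so6_module q act W'" "W' \<noteq> {0}" for W'
  proof -
    note inv = so6_submodule_invariant[OF W'(2,1)]
    have "vec.subspace W'"
      using W'(2) by (simp add: so6_module_def)
    then show ?thesis
      by (rule invariant_subspace_eq_Lambda[OF graph inj _ W'(1,3)
            inv[OF B1[unfolded Uq_B_def] k(1)] inv[OF B3[unfolded Uq_B_def] k(1)]
            inv[OF B5[unfolded Uq_B_def] k(1)] inv[OF B4[unfolded Uq_B_def] k(2)]
            inv[OF B6[unfolded Uq_B6_def] k(2)] inv[OF B2[unfolded Uq_B_def] k(2)]])
  qed
  with module Lambda_nonzero show ?thesis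
    unfolding so6_irreducible_def by blast
qed

end
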